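(* Let $K$ be a number field, $\gamma, m \in K$, $g_{\gamma,m}(x) = (x-\gamma)^2 + \gamma + m$, and $n$ a positive integer. Suppose $g_{\gamma,m}^n(x)$ is irreducible over $K$ and $g_{\gamma,m}^{n+1}(x) = p_1(x)p_2(x)$ with $p_1(x), p_2(x) \in K[x]$ non-constant. If $\alpha$ is a root of $p_1(x)$, then $2\gamma - \alpha$ is not a root of $p_1(x)$.
   Context: $g_{\gamma,m}^n$ denotes the $n$-fold composition of $g_{\gamma,m}$ with itself. *)

theory Defs
  imports
    "HOL-Algebra.Algebraic_Closure_Type"
    "HOL-Computational_Algebra.Computational_Algebra"
begin

(* Finite-dimensional over the rationals; the sort field_char_0 makes of_rat an embedding. *)
definition number_field :: "'k::field_char_0 itself \<Rightarrow> bool" where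
  "number_field _ \<longleftrightarrow>
     (\<exists>B::'k set. finite B \<and> module.span (\<lambda>(q::rat) x. of_rat q * x) B = UNIV)"

lemma vector_space_of_rat:
  "vector_space (\<lambda>(q::rat) (x::'k::field_char_0). of_rat q * x)"
  by unfold_locales (simp_all add: algebra_simps of_rat_add of_rat_mult)

definition g_poly :: "'k::comm_ring_1 \<Rightarrow> 'k \<Rightarrow> 'k poly" where
  "g_poly \<gamma> m = [:-\<gamma>, 1:]^2 + [:\<gamma>:] + [:m:]"

(* The n-fold composition of g with itself; [:0, 1:] is the polynomial x. *)
definition poly_iterate :: "'k::comm_ring_1 poly \<Rightarrow> nat \<Rightarrow> 'k poly" where
  "poly_iterate g n = (pcompose g ^^ n) [:0, 1:]"

end

theory Submission
  imports Defs
begin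

text \<open>Put \<open>F = g\<^sup>n\<close>. Every polynomial can be written as \<open>p = A(g) + (x - \<gamma>) B(g)\<close>, and the
  reflection \<open>x \<mapsto> 2\<gamma> - x\<close> fixes \<open>g\<close> and changes the sign of \<open>x - \<gamma>\<close>. So if \<open>\<alpha>\<close> and \<open>2\<gamma> - \<alpha>\<close> are
  both roots of \<open>p1\<close> and \<open>\<alpha> \<noteq> \<gamma>\<close>, then \<open>g(\<alpha>)\<close> is a common root of \<open>A\<close>, \<open>B\<close> and the irreducible
  \<open>F\<close>. Hence \<open>F\<close> divides \<open>A\<close> and \<open>B\<close>, and \<open>F(g) = p1 p2\<close> divides \<open>p1\<close>, so \<open>p2\<close> is constant.
  The case \<open>\<alpha> = \<gamma>\<close> is impossible because \<open>F\<close> would have the root \<open>g(\<gamma>)\<close> in \<open>K\<close>.\<close>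

lemma poly_map_poly_to_ac_simps:
  "poly (map_poly to_ac (p + q)) x = poly (map_poly to_ac p) x + poly (map_poly to_ac q) x"
  "poly (map_poly to_ac (p * q)) x = poly (map_poly to_ac p) x * poly (map_poly to_ac q) x"
  "poly (map_poly to_ac (pcompose p q)) x = poly (map_poly to_ac p) (poly (map_poly to_ac q) x)"
proof -
  show 1: "poly (map_poly to_ac (p + q)) x = poly (map_poly to_ac p) x + poly (map_poly to_ac q) x"
    for p q :: "'a poly"
  proof -
    have "map_poly to_ac (p + q) = map_poly to_ac p + map_poly to_ac q"
      by (simp add: poly_eq_iff coeff_map_poly)
    then show ?thesis by simp
  qed
  have smult: "map_poly to_ac (smult a p) = smult (to_ac a) (map_poly to_ac p)"
    for a and p :: "'a poly"
    by (simp add: poly_eq_iff coeff_map_poly)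
  show 2: "poly (map_poly to_ac (p * q)) x = poly (map_poly to_ac p) x * poly (map_poly to_ac q) x"
    for p q :: "'a poly"
    by (induction p) (simp_all add: 1 smult map_poly_pCons algebra_simps)
  show "poly (map_poly to_ac (pcompose p q)) x = poly (map_poly to_ac p) (poly (map_poly to_ac q) x)"
    by (induction p) (simp_all add: 1 2 pcompose_pCons map_poly_pCons)
qed

text \<open>Up to a unit, \<open>M\<close> below is the minimal polynomial of \<open>x\<close>:
  being nonzero of least degree among the polynomials vanishing at \<open>x\<close>, it divides all
  of them, by division with remainder. It divides \<open>F\<close> and is no unit, so irreducibility
  makes \<open>F\<close> and \<open>M\<close> associates.\<close>

lemma irreducible_dvd_of_common_root:
  fixes F A :: "'a::field poly"
  assumes F: "irreducible F" and F_root: "poly (map_poly to_ac F) x = 0"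
    and A_root: "poly (map_poly to_ac A) x = 0"
  shows "F dvd A"
proof -
  define annihilates where "annihilates P \<longleftrightarrow> P \<noteq> 0 \<and> poly (map_poly to_ac P) x = 0" for P
  have "annihilates F"
    using F F_root by (auto simp: annihilates_def)
  then obtain M where M: "annihilates M" and least: "\<And>P. annihilates P \<Longrightarrow> degree M \<le> degree P"
    using ex_has_least_nat[of annihilates F degree] by blast
  have M_dvd: "M dvd P" if "poly (map_poly to_ac P) x = 0" for P
  proof (rule ccontr)
    assume nz: "\<not> M dvd P"
    then have ne: "P mod M \<noteq> 0" by (simp add: mod_eq_0_iff_dvd)
    have "poly (map_poly to_ac (P div M * M + P mod M)) x = 0"
      using that by simp
    then have "poly (map_poly to_ac (P mod M)) x = 0"
      using M unfolding poly_map_poly_to_ac_simps annihilates_def by simp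
    then have "degree M \<le> degree (P mod M)"
      using ne by (intro least) (simp add: annihilates_def)
    then show False
      using degree_mod_less'[of M P] M ne by (simp add: annihilates_def)
  qed
  obtain c where c: "F = M * c"
    using M_dvd[OF F_root] by (elim dvdE)
  \<comment> \<open>A unit is a nonzero constant and cannot vanish at \<open>x\<close>.\<close>
  have "\<not> is_unit M"
    using M by (auto simp: annihilates_def is_unit_poly_iff map_poly_pCons)
  then have "is_unit c"
    using irreducibleD[OF F c] by blast
  then have "F dvd M"
    by (simp add: c)
  then show ?thesis
    using M_dvd[OF A_root] dvd_trans by blast
qed

lemma poly_map_to_ac_g_poly [simp]:
  "poly (map_poly to_ac (g_poly \<gamma> m)) x = (x - to_ac \<gamma>)^2 + to_ac \<gamma> + to_ac m"
  by (simp add: g_poly_def poly_map_poly_to_ac_simps map_poly_pCons power2_eq_square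
      del: mult_pCons_left mult_pCons_right add_pCons)

lemma degree_g_poly [simp]: "degree (g_poly \<gamma> (m :: 'a::field)) = 2"
  by (simp add: g_poly_def power2_eq_square)

text \<open>Horner-style induction: multiplying by the variable is multiplying by
  \<open>\<gamma>\<close> plus multiplying by \<open>[:-\<gamma>, 1:]\<close>, and the square of the
  latter, which then arises, is again a polynomial in \<open>g_poly \<gamma> m\<close>.\<close>

lemma g_poly_decomposition:
  obtains A B where "p = pcompose A (g_poly \<gamma> m) + [:-\<gamma>, 1:] * pcompose B (g_poly \<gamma> m)"
proof (induction p arbitrary: thesis)
  case 0
  show ?case by (rule 0[of 0 0]) simp
next
  case (pCons a q)
  let ?g = "g_poly \<gamma> m"
  obtain A B where q: "q = pcompose A ?g + [:-\<gamma>, 1:] * pcompose B ?g"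
    using pCons.IH by blast
  have x: "pCons 0 r = [:\<gamma>:] * r + [:-\<gamma>, 1:] * r" for r :: "'a poly"
    by simp
  have square: "[:-\<gamma>, 1:] * [:-\<gamma>, 1:] = ?g - [:\<gamma> + m:]"
    by (simp add: g_poly_def power2_eq_square)
  have "pCons a q = [:a:] + [:\<gamma>:] * q + [:-\<gamma>, 1:] * q"
    using x[of q] by (metis add.assoc add.commute pCons_0_0 add_pCons add_0_left add_0_right)
  also have "\<dots> = [:a:] + [:\<gamma>:] * pcompose A ?g
      + ([:-\<gamma>, 1:] * [:-\<gamma>, 1:]) * pcompose B ?g
      + [:-\<gamma>, 1:] * (pcompose A ?g + [:\<gamma>:] * pcompose B ?g)"
    unfolding q by (simp only: ring_distribs mult.left_commute mult.assoc add.left_commute add.assoc add.commute)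
  \<comment> \<open>The factor \<open>[:-(\<gamma> + m), 1:]\<close> is chosen because its
    composition with \<open>?g\<close> is the square of \<open>[:-\<gamma>, 1:]\<close>.\<close>
  also have "\<dots> = pcompose ([:a:] + [:\<gamma>:] * A + [:-(\<gamma> + m), 1:] * B) ?g
      + [:-\<gamma>, 1:] * pcompose (A + [:\<gamma>:] * B) ?g"
  proof -
    have "pcompose [:-(\<gamma> + m), 1:] ?g = ?g - [:\<gamma> + m:]"
      by (simp add: pcompose_pCons)
    then show ?thesis
      unfolding square pcompose_add pcompose_mult by (simp only: pcompose_const)
  qed
  finally show ?case by (rule pCons.prems)
qed

text \<open>The definition adds each new \<open>g\<close> on the outside. Having it innermost
  exhibits the factored iterate as a polynomial in \<open>g\<close>.\<close>

lemma poly_iterate_Suc_right: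
  "poly_iterate g (Suc n) = pcompose (poly_iterate g n) g"
proof (induction n)
  case 0
  show ?case by (simp add: poly_iterate_def pcompose_pCons)
next
  case (Suc n)
  have "poly_iterate g (Suc (Suc n)) = pcompose g (poly_iterate g (Suc n))"
    by (simp add: poly_iterate_def)
  also have "\<dots> = pcompose (pcompose g (poly_iterate g n)) g"
    unfolding Suc by (simp add: pcompose_assoc)
  finally show ?case by (simp add: poly_iterate_def)
qed

lemma degree_poly_iterate:
  fixes g :: "'a::idom poly"
  shows "degree (poly_iterate g n) = degree g ^ n"
  by (induction n) (simp_all add: poly_iterate_def degree_pcompose)

theorem theorem3p1:
  fixes \<gamma> m :: "'k::field_char_0"
    and n :: nat
    and p1 p2 :: "'k poly"
    and \<alpha> :: "'k alg_closure"
  assumes "number_field TYPE('k)"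
    and "n > 0"
    and "irreducible (poly_iterate (g_poly \<gamma> m) n)"
    and "poly_iterate (g_poly \<gamma> m) (n + 1) = p1 * p2"
    and "degree p1 > 0" and "degree p2 > 0"
    and "poly (map_poly to_ac p1) \<alpha> = 0"
  shows "poly (map_poly to_ac p1) (2 * to_ac \<gamma> - \<alpha>) \<noteq> 0"
proof
  assume reflected: "poly (map_poly to_ac p1) (2 * to_ac \<gamma> - \<alpha>) = 0"
  let ?g = "g_poly \<gamma> m"
  define F where "F = poly_iterate ?g n"
  define \<beta> where "\<beta> = (\<alpha> - to_ac \<gamma>)^2 + to_ac \<gamma> + to_ac m"
  have F: "irreducible F"
    using assms(3) by (simp add: F_def)
  have Fg: "pcompose F ?g = p1 * p2"
    using assms(4) by (simp add: F_def poly_iterate_Suc_right)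
  have "poly (map_poly to_ac (pcompose F ?g)) \<alpha> = 0"
    unfolding Fg poly_map_poly_to_ac_simps using assms(7) by simp
  then have F_root: "poly (map_poly to_ac F) \<beta> = 0"
    by (simp add: poly_map_poly_to_ac_simps \<beta>_def)
  have ne: "\<alpha> \<noteq> to_ac \<gamma>"
  proof
    assume "\<alpha> = to_ac \<gamma>"
    \<comment> \<open>Now \<open>\<beta>\<close> is the image of \<open>\<gamma> + m\<close>, so
      \<open>F\<close> would divide a linear polynomial, although its degree \<open>2 ^ n\<close>
      exceeds 1 by \<open>n > 0\<close>.\<close>
    then have "poly (map_poly to_ac [:-(\<gamma> + m), 1:]) \<beta> = 0"
      by (simp add: \<beta>_def map_poly_pCons)
    then have "F dvd [:-(\<gamma> + m), 1:]"
      using irreducible_dvd_of_common_root[OF F F_root] by blast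
    then have "degree F \<le> 1"
      using dvd_imp_degree_le[of F "[:-(\<gamma> + m), 1:]"] by simp
    moreover have "degree F = 2 ^ n"
      by (simp add: F_def degree_poly_iterate)
    ultimately show False
      using \<open>n > 0\<close> one_less_power[of "2::nat" n] by simp
  qed
  obtain A B where p1: "p1 = pcompose A ?g + [:-\<gamma>, 1:] * pcompose B ?g"
    by (rule g_poly_decomposition)
  have eval: "poly (map_poly to_ac p1) x =
      poly (map_poly to_ac A) ((x - to_ac \<gamma>)^2 + to_ac \<gamma> + to_ac m)
      + (x - to_ac \<gamma>) * poly (map_poly to_ac B) ((x - to_ac \<gamma>)^2 + to_ac \<gamma> + to_ac m)" for x
    unfolding p1 poly_map_poly_to_ac_simps by (simp add: map_poly_pCons)
  have plus: "poly (map_poly to_ac A) \<beta> + (\<alpha> - to_ac \<gamma>) * poly (map_poly to_ac B) \<beta> = 0"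
    using assms(7) unfolding eval \<beta>_def .
  have "(2 * to_ac \<gamma> - \<alpha> - to_ac \<gamma>)^2 + to_ac \<gamma> + to_ac m = \<beta>"
    by (simp add: \<beta>_def power2_eq_square algebra_simps)
  then have minus: "poly (map_poly to_ac A) \<beta> - (\<alpha> - to_ac \<gamma>) * poly (map_poly to_ac B) \<beta> = 0"
    using reflected unfolding eval by (simp add: algebra_simps)
  \<comment> \<open>Characteristic 0 allows the division by 2.\<close>
  have "P = 0" if "P + Q = 0" and "P - Q = 0" for P Q :: "'k alg_closure"
  proof -
    have "2 * P = (P + Q) + (P - Q)" by simp
    then show ?thesis using that by simp
  qed
  from this[OF plus minus] have A_root: "poly (map_poly to_ac A) \<beta> = 0" .
  then have B_root: "poly (map_poly to_ac B) \<beta> = 0"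
    using plus ne by simp
  have "F dvd A" and "F dvd B"
    using irreducible_dvd_of_common_root[OF F F_root] A_root B_root by blast+
  \<comment> \<open>Composition with \<open>?g\<close> preserves divisibility, so both summands of
    \<open>p1\<close> are multiples of \<open>pcompose F ?g\<close>.\<close>
  then have "pcompose F ?g dvd p1"
    unfolding p1 by (metis dvd_add dvd_mult dvd_def pcompose_mult)
  \<comment> \<open>Since \<open>p1\<close> is nonzero, divisibility bounds degrees, which leaves no
    room for a nonconstant \<open>p2\<close>.\<close>
  then have "degree (p1 * p2) \<le> degree p1"
    unfolding Fg using assms(5) by (intro dvd_imp_degree_le) auto
  moreover have "degree (p1 * p2) = degree p1 + degree p2"
    using assms(5,6) by (intro degree_mult_eq) auto
  ultimately show False
    using assms(6) by simp
qed

end
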